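(* Let $A=(a_{ij})$ be an $n\times n$ real symmetric positive semidefinite matrix. Let $v_1,\dots,v_k\in\mathbb{R}^k$ with $k\ge 2$ and let $B=(b_{ij})$ with $b_{ij}=\langle v_i,v_j\rangle$. Then $$\max_{x_1,\dots,x_n\in S^{n-1}}\sum_{i,j=1}^n a_{ij}\langle x_i,x_j\rangle\le\frac{1}{C(B)}\max_{\sigma:\{1,\dots,n\}\to\{1,\dots,k\}}\sum_{i,j=1}^n a_{ij}\langle v_{\sigma(i)},v_{\sigma(j)}\rangle.$$
   Context: $S^{n-1}$ is the unit sphere of $\mathbb{R}^n$. $\gamma_{k-1}$ is the standard Gaussian measure on $\mathbb{R}^{k-1}$. $C(B)$ is the maximum, over all partitions $\{A_1,\dots,A_k\}$ of $\mathbb{R}^{k-1}$ into measurable sets, of $\sum_{i,j=1}^k b_{ij}\langle z_i,z_j\rangle$ with $z_i=\int_{A_i}x\,d\gamma_{k-1}(x)$. *)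

theory Defs
  imports "HOL-Probability.Probability"
begin

definition sym_psd :: "real^'n^'n \<Rightarrow> bool" where
  "sym_psd A \<longleftrightarrow> transpose A = A \<and> (\<forall>x. 0 \<le> x \<bullet> (A *v x))"

definition std_gaussian :: "(real^'m) measure" where
  "std_gaussian = density lborel (\<lambda>x. ennreal (\<Prod>i\<in>UNIV. std_normal_density (x $ i)))"

text \<open>The parts of a partition are labelled by the index type and some of them may be empty.\<close>

definition meas_partition :: "('k \<Rightarrow> (real^'m) set) \<Rightarrow> bool" where
  "meas_partition P \<longleftrightarrow>
     (\<forall>i. P i \<in> sets borel) \<and> disjoint_family P \<and> (\<Union>i. P i) = UNIV"

definition gaussian_moment :: "(real^'m) set \<Rightarrow> real^'m" where
  "gaussian_moment S = set_lebesgue_integral std_gaussian S (\<lambda>x. x)"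

text \<open>
  The constant \<open>C(B)\<close>, for a \<open>k \<times> k\<close> matrix \<open>B\<close>. The type argument supplies the
  Euclidean space that is partitioned; it is the space of dimension \<open>k - 1\<close> only if
  \<open>CARD('m) = CARD('k) - 1\<close>, which has to be assumed wherever the constant is used.
  \<open>GREATEST\<close> is an attained maximum (not a supremum).
\<close>

definition gaussian_const :: "(real^'m) itself \<Rightarrow> real^'k^'k \<Rightarrow> real" where
  "gaussian_const _ B =
     (GREATEST c. \<exists>P :: 'k \<Rightarrow> (real^'m) set. meas_partition P \<and>
        c = (\<Sum>i\<in>UNIV. \<Sum>j\<in>UNIV.
               B $ i $ j * (gaussian_moment (P i) \<bullet> gaussian_moment (P j))))"

end

(* Fix a partition P attaining C(B), let F y = v_p for y in the cell P_p, and let L be the linear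
   part of F, that is L y = (sum over t) y_t c_t with c_t the integral of y_t F(y) against the
   Gaussian measure; then C(B) is the sum of the squared norms of the c_t.  For unit vectors x_i
   and a Gaussian matrix G put F_i = F(G x_i) and L_i = L(G x_i).  Positive semidefiniteness gives
     sum a_ij <F_i, F_j>  >=  sum a_ij (<F_i, L_j> + <L_i, F_j> - <L_i, L_j>).
   The left side is the value of an assignment sigma, hence at most the maximum.  By rotation
   invariance of the Gaussian each inner product on the right has expectation C(B) <x_i, x_j>,
   and taking expectations gives the theorem.

   The maximum C(B) is attained: take a maximiser z of the convex form on the closure of the
   set of moment vectors, and linearise the form at z.  A linear functional of the moments is
   maximised by the partition into the cells where <w_i, x> is largest, so this partition is
   at least as good as z. *)
theory Submission
  imports Defs
begin

subsection \<open>Orthogonal invariance of the Gaussian measure\<close>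

abbreviation std_normal :: "real measure" where
  "std_normal \<equiv> density lborel (\<lambda>x. ennreal (std_normal_density x))"

lemma sets_std_gaussian [simp, measurable_cong]: "sets std_gaussian = sets borel"
  by (simp add: std_gaussian_def)

lemma space_std_gaussian [simp]: "space std_gaussian = UNIV"
  by (simp add: std_gaussian_def)

lemma rect_in_sets_borel:
  fixes A :: "'d::finite \<Rightarrow> real set"
  assumes "\<And>i. A i \<in> sets borel"
  shows "{x :: real^'d. \<forall>i. x $ i \<in> A i} \<in> sets borel"
proof -
  have [measurable]: "A i \<in> sets borel" for i by fact
  show ?thesis by measurable
qed

text \<open>The density is a product of one-dimensional densities and Lebesgue measure factors over
  coordinates, so the coordinates are independent standard normal variables. Images of the measure
  are identified through this product formula.\<close>

lemma emeasure_std_gaussian_rect: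
  fixes A :: "'d::finite \<Rightarrow> real set"
  assumes A [measurable]: "\<And>i. A i \<in> sets borel"
  shows "emeasure std_gaussian {x :: real^'d. \<forall>i. x $ i \<in> A i} = (\<Prod>i\<in>UNIV. emeasure std_normal (A i))"
proof -
  \<comment> \<open>\<open>nn_integral_lborel_prod\<close> multiplies over \<open>Basis\<close>, the
    density over indices; \<open>ix\<close> recovers the index of an axis vector.\<close>
  define ix :: "real^'d \<Rightarrow> 'd" where "ix b = (SOME i. b = axis i 1)" for b
  have ix: "ix (axis i 1) = i" for i
    unfolding ix_def by (auto simp: axis_eq_axis)
  have prod_Basis: "(\<Prod>b\<in>Basis. f b) = (\<Prod>i\<in>UNIV. f (axis i 1))" for f :: "real^'d \<Rightarrow> ennreal"
  proof -
    have eq: "(Basis :: (real^'d) set) = range (\<lambda>i. axis i 1)"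
      by (auto simp: Basis_vec_def)
    show ?thesis
      unfolding eq by (subst prod.reindex) (auto simp: inj_on_def axis_eq_axis)
  qed
  let ?f = "\<lambda>b x. std_normal_density x * indicator (A (ix b)) x :: real"
  have m: "{x :: real^'d. \<forall>i. x $ i \<in> A i} \<in> sets borel" by (rule rect_in_sets_borel) simp
  have "emeasure std_gaussian {x :: real^'d. \<forall>i. x $ i \<in> A i}
      = (\<integral>\<^sup>+x. ennreal (\<Prod>i\<in>UNIV. std_normal_density (x $ i)) * indicator {x. \<forall>i. x $ i \<in> A i} x \<partial>lborel)"
    unfolding std_gaussian_def using m by (subst emeasure_density) auto
  also have "\<dots> = (\<integral>\<^sup>+x. (\<Prod>b\<in>Basis. ennreal (?f b (x \<bullet> b))) \<partial>lborel)"
  proof (rule nn_integral_cong)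
    fix x :: "real^'d"
    have "(indicator {x :: real^'d. \<forall>i. x $ i \<in> A i} x :: real) = (\<Prod>i\<in>UNIV. indicator (A i) (x $ i))"
      by (auto simp: indicator_def prod_zero_iff) 
    then show "ennreal (\<Prod>i\<in>UNIV. std_normal_density (x $ i)) * indicator {x. \<forall>i. x $ i \<in> A i} x
       = (\<Prod>b\<in>Basis. ennreal (?f b (x \<bullet> b)))"
      by (simp add: prod_Basis ix inner_axis prod.distrib prod_ennreal ennreal_mult' prod_nonneg
          flip: ennreal_indicator)
  qed
  also have "\<dots> = (\<Prod>b\<in>Basis. (\<integral>\<^sup>+x. ennreal (?f b x) \<partial>lborel))"
  proof -
    have "(\<integral>\<^sup>+x. (\<Prod>b\<in>Basis. ennreal (?f b (x \<bullet> b))) \<partial>lborel) = (\<Prod>b\<in>Basis. (\<integral>\<^sup>+x. ennreal (?f b x) \<partial>lborel))"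
      by (rule nn_integral_lborel_prod) auto
    then show ?thesis .
  qed
  also have "\<dots> = (\<Prod>i\<in>UNIV. emeasure std_normal (A i))"
    by (auto simp: prod_Basis ix emeasure_density ennreal_mult' ennreal_indicator intro!: prod.cong)
  finally show ?thesis .
qed

lemma prob_space_std_normal: "prob_space std_normal"
  by (rule prob_space_normal_density) simp

interpretation std_normal: prob_space std_normal
  by (rule prob_space_std_normal)

interpretation std_gaussian: prob_space "std_gaussian :: (real^'d) measure"
proof
  show "emeasure (std_gaussian :: (real^'d) measure) (space std_gaussian) = 1"
    using emeasure_std_gaussian_rect[of "\<lambda>_::'d. UNIV"] std_normal.emeasure_space_1 by simp
qed

text \<open>Open boxes are rectangles, form an intersection-stable generator of the Borel sets and
  exhaust the space, so the product formula on rectangles determines the measure.\<close>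

lemma std_gaussian_eqI:
  fixes M :: "(real^'d::finite) measure"
  assumes sets: "sets M = sets borel"
    and em: "\<And>A. (\<And>i. A i \<in> sets borel) \<Longrightarrow>
      emeasure M {x. \<forall>i. x $ i \<in> A i} = (\<Prod>i\<in>UNIV. emeasure std_normal (A i))"
  shows "M = std_gaussian"
proof (rule measure_eqI_generator_eq[symmetric])
  let ?E = "range (\<lambda>(a, b). box a b::(real^'d) set)"
  show "Int_stable ?E"
    by (auto simp: Int_stable_def box_Int_box)
  show "?E \<subseteq> Pow UNIV" "sets std_gaussian = sigma_sets UNIV ?E" "sets M = sigma_sets UNIV ?E"
    by (simp_all add: borel_eq_box sets)
  let ?A = "\<lambda>n::nat. box (- (real n *\<^sub>R One)) (real n *\<^sub>R One) :: (real^'d) set"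
  show "range ?A \<subseteq> ?E" "(\<Union>i. ?A i) = UNIV"
    unfolding UN_box_eq_UNIV by auto
  show "emeasure std_gaussian (?A i) \<noteq> \<infinity>" for i
    by (simp add: std_gaussian.emeasure_eq_measure)
  show "emeasure std_gaussian X = emeasure M X" if "X \<in> ?E" for X
  proof -
    from that obtain a b :: "real^'d" where "X = box a b" by auto
    then have "X = {x. \<forall>i. x $ i \<in> {a $ i<..<b $ i}}"
      by (auto simp: mem_box_cart)
    moreover have "{a $ i<..<b $ i} \<in> sets borel" for i by simp
    ultimately show ?thesis
      by (simp only: em emeasure_std_gaussian_rect)
  qed
qed

text \<open>The preimage of a rectangle is a rectangle whose unselected sides are the whole line and
  contribute the factor 1. This serves to discard coordinates and to extract a column of a Gaussian
  matrix.\<close>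

lemma distr_std_gaussian_reindex:
  fixes h :: "'m::finite \<Rightarrow> 'd::finite"
  assumes h: "inj h"
  shows "distr std_gaussian borel (\<lambda>x :: real^'d. \<chi> t. x $ h t) = std_gaussian"
proof (rule std_gaussian_eqI)
  fix A :: "'m \<Rightarrow> real set" assume A: "\<And>i. A i \<in> sets borel"
  have m: "(\<lambda>x :: real^'d. \<chi> t. x $ h t) \<in> borel_measurable borel"
    by (intro borel_measurable_continuous_onI continuous_intros)
  let ?B = "\<lambda>d. if d \<in> range h then A (inv h d) else UNIV"
  have "(\<forall>i. y (h i) \<in> A i) \<longleftrightarrow> (\<forall>d. y d \<in> ?B d)" for y
    using h by (metis UNIV_I inv_f_f f_inv_into_f rangeI)
  then have "(\<lambda>x :: real^'d. \<chi> t. x $ h t) -` {x. \<forall>i. x $ i \<in> A i} = {x. \<forall>d. x $ d \<in> ?B d}"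
    by auto
  then have "emeasure (distr std_gaussian borel (\<lambda>x :: real^'d. \<chi> t. x $ h t)) {x. \<forall>i. x $ i \<in> A i}
     = emeasure std_gaussian {x. \<forall>d. x $ d \<in> ?B d}"
    using m rect_in_sets_borel[of A, OF A] by (subst emeasure_distr) auto
  also have "\<dots> = (\<Prod>d\<in>UNIV. emeasure std_normal (?B d))"
    using A by (intro emeasure_std_gaussian_rect) auto
  also have "\<dots> = (\<Prod>d\<in>range h. emeasure std_normal (?B d))"
    using std_normal.emeasure_space_1 by (intro prod.mono_neutral_right) auto
  also have "\<dots> = (\<Prod>i\<in>UNIV. emeasure std_normal (A i))"
    using h by (subst prod.reindex) auto
  finally show "emeasure (distr std_gaussian borel (\<lambda>x :: real^'d. \<chi> t. x $ h t)) {x. \<forall>i. x $ i \<in> A i}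
     = (\<Prod>i\<in>UNIV. emeasure std_normal (A i))" .
qed simp

lemma distr_std_gaussian_nth: "distr std_gaussian borel (\<lambda>x :: real^'d::finite. x $ a) = std_normal"
proof (rule measure_eqI)
  fix S :: "real set" assume "S \<in> sets (distr std_gaussian borel (\<lambda>x :: real^'d. x $ a))"
  then have S: "S \<in> sets borel" by simp
  have "(\<lambda>x :: real^'d. x $ a) -` S = {x. \<forall>d. x $ d \<in> (if d = a then S else UNIV)}"
    by auto
  then have "emeasure (distr std_gaussian borel (\<lambda>x :: real^'d. x $ a)) S
    = emeasure std_gaussian {x :: real^'d. \<forall>d. x $ d \<in> (if d = a then S else UNIV)}"
    using S by (subst emeasure_distr) auto
  also have "\<dots> = (\<Prod>d\<in>UNIV. emeasure std_normal (if d = a then S else UNIV))"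
    using S by (intro emeasure_std_gaussian_rect) auto
  also have "\<dots> = (\<Prod>d\<in>{a}. emeasure std_normal S)"
    using std_normal.emeasure_space_1 by (intro prod.mono_neutral_cong_right) auto
  finally show "emeasure (distr std_gaussian borel (\<lambda>x :: real^'d. x $ a)) S = emeasure std_normal S"
    by simp
qed simp

text \<open>An orthogonal map preserves Lebesgue measure (\<open>lb\<close>) and the norm, and the
  Gaussian density is a function of the norm alone (\<open>dens\<close>).\<close>

lemma distr_std_gaussian_orthogonal_wellorder:
  fixes T :: "(real, 'd::{finite,wellorder}) vec \<Rightarrow> (real, 'd) vec"
  assumes T: "orthogonal_transformation T"
  shows "distr std_gaussian borel T = std_gaussian"
proof -
  have lin: "linear T" using T by (rule orthogonal_transformation_linear)
  then have m [measurable]: "T \<in> borel_measurable borel"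
    by (intro borel_measurable_continuous_onI linear_continuous_on linear_conv_bounded_linear[THEN iffD1])
  obtain S where S: "orthogonal_transformation S" "\<And>x. S (T x) = x" "\<And>x. T (S x) = x"
    
  proof
    show "orthogonal_transformation (inv T)" using T by (rule orthogonal_transformation_inv)
    show "inv T (T x) = x" "T (inv T x) = x" for x
      using orthogonal_transformation_bij[OF T] by (simp_all add: bij_is_inj bij_is_surj surj_f_inv_f)
  qed
  \<comment> \<open>The preimage of a box under \<open>T\<close> is its image under the inverse
    \<open>S\<close>, to which invariance of Lebesgue measure under orthogonal images applies; boxes
    determine \<open>lborel\<close>.\<close>
  have lb: "distr lborel borel T = lborel"
  proof (rule lborel_eqI[symmetric])
    fix l u :: "(real, 'd) vec" assume le: "\<And>b. b \<in> Basis \<Longrightarrow> l \<bullet> b \<le> u \<bullet> b"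
    have eq: "T -` box l u = S ` box l u"
    proof (intro set_eqI iffI)
      fix x assume "x \<in> T -` box l u"
      then have "T x \<in> box l u" by simp
      then show "x \<in> S ` box l u" using S(2)[of x] by (metis imageI)
    qed (use S(3) in auto)
    have "box l u \<in> lmeasurable" by simp
    then have "S ` box l u \<in> lmeasurable"  "measure lebesgue (S ` box l u) = measure lebesgue (box l u)"
      using S(1) measurable_orthogonal_image measure_orthogonal_image by blast+
    moreover have sb: "S ` box l u \<in> sets borel"
      using measurable_sets[OF m, of "box l u"] by (simp add: eq)
    moreover have "emeasure lborel X = ennreal (measure lebesgue X)"
      if "X \<in> lmeasurable" "X \<in> sets borel" for X :: "(real, 'd) vec set"
      using emeasure_eq_measure2[OF that(1)] that(2) by simp
    moreover have "emeasure (distr lborel borel T) (box l u) = emeasure lborel (T -` box l u \<inter> space lborel)"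
      by (rule emeasure_distr) auto
    ultimately show "emeasure (distr lborel borel T) (box l u) = ennreal (\<Prod>b\<in>Basis. (u - l) \<bullet> b)"
      using emeasure_lborel_box[OF le] by (simp add: eq)
  qed simp
  let ?f = "\<lambda>x :: (real, 'd) vec. ennreal (\<Prod>i\<in>UNIV. std_normal_density (x $ i))"
  have dens: "(\<Prod>i\<in>UNIV. std_normal_density (x $ i))
      = (1 / sqrt (2 * pi)) ^ CARD('d) * exp (- (norm x)\<^sup>2 / 2)" for x :: "(real, 'd) vec"
  proof -
    have "(\<Prod>i\<in>UNIV. std_normal_density (x $ i)) = (1 / sqrt (2 * pi)) ^ CARD('d) * exp (\<Sum>i\<in>UNIV. - (x $ i)\<^sup>2 / 2)"
      unfolding std_normal_density_def prod.distrib prod_constant by (subst exp_sum) simp_all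
    also have "(\<Sum>i\<in>UNIV. - (x $ i)\<^sup>2 / 2) = - (norm x)\<^sup>2 / 2"
      unfolding power2_norm_eq_inner inner_vec_def inner_real_def power2_eq_square[of "x $ _"]
      by (simp only: sum_negf[symmetric] sum_divide_distrib)
    finally show ?thesis .
  qed
  have fT: "?f (T x) = ?f x" for x
    by (simp add: dens orthogonal_transformation_norm[OF T])
  have "density (distr lborel borel T) ?f = distr (density lborel (\<lambda>x. ?f (T x))) borel T"
    by (rule density_distr) (auto intro!: borel_measurable_prod measurable_compose[OF borel_measurable_nth])
  then show ?thesis
    unfolding std_gaussian_def fT lb by simp
qed

text \<open>The library has the invariance of Lebesgue measure only for well-ordered index types. Such
  a type is \<open>'d bit0\<close>, which has more elements than \<open>'d\<close>; an orthogonal map is extended to it by the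
  identity on the extra coordinates.\<close>

lemma distr_std_gaussian_orthogonal:
  fixes T :: "real^'d \<Rightarrow> real^'d"
  assumes T: "orthogonal_transformation T"
  shows "distr std_gaussian borel T = std_gaussian"
proof -
  have lin: "linear T" using T by (rule orthogonal_transformation_linear)
  have borel: "f \<in> borel_measurable borel" if "linear f" for f :: "real^'a \<Rightarrow> real^'b"
    using that by (intro borel_measurable_continuous_onI linear_continuous_on linear_conv_bounded_linear[THEN iffD1])
  have "\<exists>h :: 'd \<Rightarrow> 'd bit0. inj h"
    using card_le_inj[of "UNIV :: 'd set" "UNIV :: 'd bit0 set"] by auto
  then obtain h :: "'d \<Rightarrow> 'd bit0" where h: "inj h" by blast
  define R :: "real^('d bit0) \<Rightarrow> real^'d" where "R g = (\<chi> t. g $ h t)" for g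
  define T' where "T' g = (\<chi> e. if e \<in> range h then T (R g) $ inv h e else g $ e)" for g
  have linR: "linear R"
    by (rule linearI) (auto simp: R_def vec_eq_iff)
  have RT: "R (T' g) = T (R g)" for g
    using h by (simp add: R_def T'_def vec_eq_iff)
  have "linear T'"
    by (rule linearI) (auto simp: T'_def vec_eq_iff linear_add[OF linR] linear_add[OF lin]
      linear_cmul[OF linR] linear_cmul[OF lin])
  moreover have "norm (T' g) = norm g" for g
  proof -
    \<comment> \<open>The squared norm splits into the coordinates in the range of \<open>h\<close>,
      on which \<open>T'\<close> acts as \<open>T\<close>, and the others, which \<open>T'\<close>
      fixes.\<close>
    have split: "z \<bullet> z = R z \<bullet> R z + (\<Sum>e\<in>- range h. z $ e * z $ e)" for z
    proof -
      have "z \<bullet> z = (\<Sum>e\<in>range h. z $ e * z $ e) + (\<Sum>e\<in>- range h. z $ e * z $ e)"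
        by (simp add: inner_vec_def Compl_eq_Diff_UNIV sum.subset_diff[of "range h" UNIV] add.commute)
      also have "(\<Sum>e\<in>range h. z $ e * z $ e) = R z \<bullet> R z"
        by (subst sum.reindex[OF h]) (simp add: inner_vec_def R_def)
      finally show ?thesis .
    qed
    have "T (R g) \<bullet> T (R g) = R g \<bullet> R g"
      using T by (simp add: orthogonal_transformation_def)
    then have "T' g \<bullet> T' g = g \<bullet> g"
      unfolding split[of "T' g"] split[of g] RT by (simp add: T'_def)
    then show ?thesis by (simp add: norm_eq_sqrt_inner)
  qed
  ultimately have T': "orthogonal_transformation T'"
    by (simp add: orthogonal_transformation)
  have [measurable]: "T \<in> borel_measurable borel" "R \<in> borel_measurable borel" "T' \<in> borel_measurable borel"
    using borel lin linR \<open>linear T'\<close> by auto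
  have R: "distr std_gaussian borel R = std_gaussian"
    unfolding R_def by (rule distr_std_gaussian_reindex[OF h])
  have "distr std_gaussian borel T = distr (distr std_gaussian borel R) borel T"
    by (simp add: R)
  \<comment> \<open>\<open>R\<close> intertwines \<open>T'\<close> with \<open>T\<close> and maps
    Gaussian to Gaussian, so invariance under \<open>T'\<close> descends to
    \<open>T\<close>.\<close>
  also have "\<dots> = distr std_gaussian borel (R \<circ> T')"
    by (subst distr_distr) (auto simp: comp_def RT)
  also have "\<dots> = distr (distr std_gaussian borel T') borel R"
    by (subst distr_distr) auto
  finally show ?thesis
    by (simp add: distr_std_gaussian_orthogonal_wellorder[OF T'] R)
qed

section \<open>Change of variables by orthogonal maps; reflections\<close>

lemma measurable_orthogonal_transformation:
  fixes T :: "real^'d \<Rightarrow> real^'d"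
  assumes "orthogonal_transformation T"
  shows "T \<in> borel_measurable borel"
  using orthogonal_transformation_linear[OF assms]
  by (intro borel_measurable_continuous_onI linear_continuous_on linear_conv_bounded_linear[THEN iffD1])

lemma integral_std_gaussian_orthogonal:
  fixes T :: "real^'d \<Rightarrow> real^'d" and f :: "real^'d \<Rightarrow> real"
  assumes T: "orthogonal_transformation T" and f: "f \<in> borel_measurable borel"
  shows "(\<integral>x. f (T x) \<partial>std_gaussian) = (\<integral>x. f x \<partial>std_gaussian)"
  using integral_distr[of T std_gaussian borel f] f measurable_orthogonal_transformation[OF T]
  by (simp add: distr_std_gaussian_orthogonal[OF T])

text \<open>The reflection in the hyperplane orthogonal to \<open>w\<close>. For
  \<open>w = 0\<close> it is the identity, a case that occurs in \<open>integral_gmul_mult\<close>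
  when \<open>y\<close> is a multiple of \<open>x\<close>.\<close>

definition reflect :: "'a::real_inner \<Rightarrow> 'a \<Rightarrow> 'a" where
  "reflect w z = z - (2 * (z \<bullet> w) / (w \<bullet> w)) *\<^sub>R w"

lemma orthogonal_transformation_reflect: "orthogonal_transformation (reflect w)"
proof -
  have "linear (reflect w)"
    by (rule linearI) (auto simp: reflect_def algebra_simps add_divide_distrib inner_add_left)
  moreover have "reflect w z \<bullet> reflect w z' = z \<bullet> z'" for z z'
    by (cases "w = 0") (auto simp: reflect_def inner_diff_left inner_diff_right field_simps inner_commute)
  ultimately show ?thesis
    by (simp add: orthogonal_transformation_def)
qed

lemma reflect_self: "reflect w w = - w"
  by (cases "w = 0") (simp_all add: reflect_def scaleR_2)

lemma reflect_orthogonal: "x \<bullet> w = 0 \<Longrightarrow> reflect w x = x"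
  by (simp add: reflect_def)

section \<open>Second moments of the Gaussian coordinates\<close>

lemma
  fixes a :: "'d::finite"
  shows integrable_std_gaussian_nth_square: "integrable std_gaussian (\<lambda>x :: real^'d. (x $ a)\<^sup>2)"
    and integral_std_gaussian_nth_square: "(\<integral>x. (x $ a)\<^sup>2 \<partial>(std_gaussian :: (real^'d) measure)) = 1"
proof -
  have "integrable std_normal (\<lambda>x. x\<^sup>2)"
    using integrable_std_normal_moment[of 2] by (subst integrable_density) (auto simp: mult.commute)
  then show "integrable std_gaussian (\<lambda>x :: real^'d. (x $ a)\<^sup>2)"
    unfolding distr_std_gaussian_nth[of a, symmetric] by (subst (asm) integrable_distr_eq) auto
  have "(\<integral>x. x\<^sup>2 \<partial>std_normal) = 1"
    using integral_std_normal_moment_even[of 1] by (subst integral_density) (auto simp: mult.commute)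
  then show "(\<integral>x. (x $ a)\<^sup>2 \<partial>(std_gaussian :: (real^'d) measure)) = 1"
    unfolding distr_std_gaussian_nth[of a, symmetric] by (subst (asm) integral_distr) auto
qed

text \<open>The product is dominated by the sum of the squares.\<close>

lemma integrable_mult_of_squares:
  fixes f g :: "'a \<Rightarrow> real"
  assumes "integrable M (\<lambda>x. (f x)\<^sup>2)" "integrable M (\<lambda>x. (g x)\<^sup>2)"
    and [measurable]: "f \<in> borel_measurable M" "g \<in> borel_measurable M"
  shows "integrable M (\<lambda>x. f x * g x)"
proof (rule Bochner_Integration.integrable_bound)
  show "integrable M (\<lambda>x. (f x)\<^sup>2 + (g x)\<^sup>2)" using assms by simp
  show "AE x in M. norm (f x * g x) \<le> norm ((f x)\<^sup>2 + (g x)\<^sup>2)"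
  proof (rule AE_I2)
    fix x
    have "2 * (\<bar>f x\<bar> * \<bar>g x\<bar>) \<le> (f x)\<^sup>2 + (g x)\<^sup>2"
      using zero_le_power2[of "\<bar>f x\<bar> - \<bar>g x\<bar>"] by (simp add: power2_eq_square algebra_simps)
    moreover have "0 \<le> \<bar>f x\<bar> * \<bar>g x\<bar>" by (rule mult_nonneg_nonneg) simp_all
    ultimately have "\<bar>f x\<bar> * \<bar>g x\<bar> \<le> (f x)\<^sup>2 + (g x)\<^sup>2" by linarith
    then show "norm (f x * g x) \<le> norm ((f x)\<^sup>2 + (g x)\<^sup>2)"
      by (simp add: abs_mult)
  qed
qed simp

lemma integrable_std_gaussian_nth: "integrable std_gaussian (\<lambda>x :: real^'d. x $ a)"
  using integrable_mult_of_squares[of std_gaussian "\<lambda>x :: real^'d. x $ a" "\<lambda>_. 1"]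
  by (auto simp: integrable_std_gaussian_nth_square)

lemma integral_std_gaussian_nth_mult:
  "(\<integral>x. x $ a * x $ b \<partial>(std_gaussian :: (real^'d) measure)) = (if a = b then 1 else 0)"
proof (cases "a = b")
  case True
  then show ?thesis using integral_std_gaussian_nth_square[of b] by (simp add: power2_eq_square)
next
  case False
  \<comment> \<open>Reflecting coordinate \<open>a\<close> alone changes the sign of the product
    when \<open>b\<close> differs from \<open>a\<close>, so the integral equals its own
    negative.\<close>
  let ?T = "reflect (axis a 1 :: real^'d)"
  have "?T x $ a * ?T x $ b = - (x $ a * x $ b)" for x
    using False by (simp add: reflect_def inner_axis) (simp add: axis_def)
  then have "- (\<integral>x. x $ a * x $ b \<partial>(std_gaussian :: (real^'d) measure)) = (\<integral>x. ?T x $ a * ?T x $ b \<partial>std_gaussian)"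
    by simp
  also have "\<dots> = (\<integral>x. x $ a * x $ b \<partial>(std_gaussian :: (real^'d) measure))"
    by (rule integral_std_gaussian_orthogonal[OF orthogonal_transformation_reflect]) measurable
  finally show ?thesis using False by simp
qed

subsection \<open>Gaussian matrices\<close>

text \<open>A matrix-vector product. The matrix is one vector indexed by pairs, so that
  \<open>std_gaussian\<close> itself is the law of a matrix with independent standard normal
  entries.\<close>

definition gmul :: "real^('m::finite \<times> 'n) \<Rightarrow> real^'n \<Rightarrow> real^'m" where
  "gmul g x = (\<chi> t. \<Sum>i\<in>UNIV. g $ (t, i) * x $ i)"

text \<open>In matrix terms this is \<open>g\<close> times the transpose of \<open>S\<close>. It
  moves rotations of the argument of \<open>gmul\<close> to the random matrix, whose law they
  preserve.\<close>

definition row_lift :: "(real^'n \<Rightarrow> real^'n) \<Rightarrow> real^('m::finite \<times> 'n) \<Rightarrow> real^('m::finite \<times> 'n)" where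
  "row_lift S g = (\<chi> p. S (\<chi> i. g $ (fst p, i)) $ snd p)"

lemma gmul_nth: "gmul g x $ t = (\<chi> i. g $ (t, i)) \<bullet> x"
  by (simp add: gmul_def inner_vec_def)

lemma gmul_diff: "gmul g (x - y) = gmul g x - gmul g y"
  by (simp add: vec_eq_iff gmul_nth inner_diff_right)

lemma gmul_scaleR: "gmul g (c *\<^sub>R x) = c *\<^sub>R gmul g x"
  by (simp add: vec_eq_iff gmul_nth)

lemma gmul_minus: "gmul g (- x) = - gmul g x"
  by (simp add: vec_eq_iff gmul_nth)

lemma gmul_axis: "gmul g (axis i 1) = (\<chi> t. g $ (t, i))"
  by (simp add: vec_eq_iff gmul_nth inner_axis)

lemma borel_measurable_gmul [measurable]: "(\<lambda>g. gmul g x) \<in> borel_measurable borel"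
  unfolding gmul_def by (intro borel_measurable_continuous_onI continuous_intros)

lemma borel_measurable_gmul_nth [measurable]: "(\<lambda>g. gmul g x $ t) \<in> borel_measurable borel"
  by (rule measurable_compose[OF borel_measurable_gmul borel_measurable_nth])

lemma row_row_lift: "(\<chi> i. row_lift S g $ (t, i)) = S (\<chi> i. g $ (t, i))"
  by (simp add: row_lift_def vec_eq_iff)

lemma gmul_row_lift:
  assumes "orthogonal_transformation S"
  shows "gmul (row_lift S g) (S x) = gmul g x"
  using assms by (simp add: vec_eq_iff gmul_nth row_row_lift orthogonal_transformation_def)

text \<open>The inner product of two matrices is the sum of the inner products of their rows, and
  \<open>S\<close> preserves each of these.\<close>

lemma orthogonal_transformation_row_lift:
  fixes S :: "real^'n \<Rightarrow> real^'n"
  assumes S: "orthogonal_transformation S"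
  shows "orthogonal_transformation (row_lift S :: real^('m::finite \<times> 'n) \<Rightarrow> _)"
proof -
  have lin: "linear S" using S by (rule orthogonal_transformation_linear)
  let ?R = "row_lift S :: real^('m \<times> 'n) \<Rightarrow> _"
  have "linear ?R"
  proof (rule linearI)
    fix g h :: "real^('m::finite \<times> 'n)" and c :: real
    have "(\<chi> i. (g + h) $ (t, i)) = (\<chi> i. g $ (t, i)) + (\<chi> i. h $ (t, i))" for t
      by (simp add: vec_eq_iff)
    then show "row_lift S (g + h) = row_lift S g + row_lift S h"
      by (simp only: row_lift_def linear_add[OF lin]) (simp add: vec_eq_iff)
    have "(\<chi> i. (c *\<^sub>R g) $ (t, i)) = c *\<^sub>R (\<chi> i. g $ (t, i))" for t
      by (simp add: vec_eq_iff)
    then show "row_lift S (c *\<^sub>R g) = c *\<^sub>R row_lift S g"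
      by (simp only: row_lift_def linear_cmul[OF lin]) (simp add: vec_eq_iff)
  qed
  moreover have "?R g \<bullet> ?R h = g \<bullet> h" for g h
  proof -
    have rows: "g \<bullet> h = (\<Sum>t\<in>UNIV. (\<chi> i. g $ (t, i)) \<bullet> (\<chi> i. h $ (t, i)))" for g h :: "real^('m::finite \<times> 'n::finite)"
      by (simp add: inner_vec_def sum.cartesian_product split_def)
    show ?thesis
      using S unfolding rows[of "?R g"] rows[of g] row_row_lift
      by (simp add: orthogonal_transformation_def)
  qed
  ultimately show ?thesis
    by (simp add: orthogonal_transformation_def)
qed

text \<open>An orthogonal map carries \<open>x\<close> to a coordinate axis; its lift preserves the
  law of \<open>g\<close>, and the product with an axis vector is a column of \<open>g\<close>. The
  index \<open>i\<close> of the axis is arbitrary.\<close>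

lemma distr_gmul:
  fixes x :: "real^'n"
  assumes x: "norm x = 1"
  shows "distr std_gaussian borel (\<lambda>g :: real^('m::finite \<times> 'n). gmul g x) = std_gaussian"
proof -
  fix i :: 'n
  obtain S :: "real^'n \<Rightarrow> real^'n" where S: "orthogonal_transformation S" and Sx: "S x = axis i 1"
    by (rule orthogonal_transformation_exists_1[OF x norm_axis_1[of i]])
  note T = orthogonal_transformation_row_lift[OF S]
  have [measurable]: "row_lift S \<in> borel_measurable borel"
    by (rule measurable_orthogonal_transformation[OF T])
  have "distr std_gaussian borel (\<lambda>g :: real^('m::finite \<times> 'n). gmul g x)
      = distr std_gaussian borel ((\<lambda>g. gmul g (axis i 1)) \<circ> row_lift S)"
    by (simp add: comp_def gmul_row_lift[OF S, of _ x, unfolded Sx])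
  also have "\<dots> = distr (distr std_gaussian borel (row_lift S)) borel (\<lambda>g. gmul g (axis i 1))"
    by (subst distr_distr) auto
  also have "\<dots> = std_gaussian"
    unfolding distr_std_gaussian_orthogonal[OF T] gmul_axis
    by (rule distr_std_gaussian_reindex) (auto simp: inj_on_def)
  finally show ?thesis .
qed

lemma
  fixes x :: "real^'n" and f :: "real^'m \<Rightarrow> real"
  assumes x: "norm x = 1" and f: "f \<in> borel_measurable borel"
  shows integrable_gmul: "integrable std_gaussian (\<lambda>g :: real^('m::finite \<times> 'n). f (gmul g x)) \<longleftrightarrow> integrable std_gaussian f"
    and integral_gmul: "(\<integral>g. f (gmul g x) \<partial>(std_gaussian :: (real^('m::finite \<times> 'n)) measure)) = (\<integral>y. f y \<partial>std_gaussian)"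
  using integrable_distr_eq[of "\<lambda>g. gmul g x" "std_gaussian :: (real^('m::finite \<times> 'n)) measure" borel f]
    integral_distr[of "\<lambda>g. gmul g x" "std_gaussian :: (real^('m::finite \<times> 'n)) measure" borel f] f
  by (simp_all add: distr_gmul[OF x])

text \<open>Write \<open>y\<close> as \<open>(x \<bullet> y) *\<^sub>R x + w\<close> with
  \<open>w\<close> orthogonal to \<open>x\<close>. Reflecting along \<open>w\<close> fixes
  \<open>gmul g x\<close> and negates \<open>gmul g w\<close>, so the part from \<open>w\<close> has
  integral zero. The remaining part involves only the single Gaussian vector
  \<open>gmul g x\<close>.\<close>

lemma
  fixes x y :: "real^'n" and h :: "real^'m \<Rightarrow> real"
  assumes x: "norm x = 1" and y: "norm y = 1"
    and h [measurable]: "h \<in> borel_measurable borel"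
    and h2: "integrable std_gaussian (\<lambda>z. (h z)\<^sup>2)"
  shows integrable_gmul_mult: "integrable std_gaussian (\<lambda>g :: real^('m::finite \<times> 'n). h (gmul g x) * gmul g y $ t)"
    and integral_gmul_mult: "(\<integral>g. h (gmul g x) * gmul g y $ t \<partial>(std_gaussian :: (real^('m::finite \<times> 'n)) measure))
      = (x \<bullet> y) * (\<integral>z. h z * z $ t \<partial>std_gaussian)"
proof -
  let ?G = "std_gaussian :: (real^('m::finite \<times> 'n)) measure"
  have int: "integrable ?G (\<lambda>g. h (gmul g x) * gmul g y $ t)" if y: "norm y = 1" for y
  proof (rule integrable_mult_of_squares)
    show "integrable ?G (\<lambda>g. (h (gmul g x))\<^sup>2)"
      using integrable_gmul[OF x, of "\<lambda>z. (h z)\<^sup>2"] h2 by auto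
    show "integrable ?G (\<lambda>g. (gmul g y $ t)\<^sup>2)"
      using integrable_gmul[OF y, of "\<lambda>z. (z $ t)\<^sup>2"] integrable_std_gaussian_nth_square by auto
  qed measurable
  then show "integrable ?G (\<lambda>g. h (gmul g x) * gmul g y $ t)" using y .
  define w where "w = y - (x \<bullet> y) *\<^sub>R x"
  have xw: "x \<bullet> w = 0"
    using x by (simp add: w_def inner_diff_right norm_eq_1)
  have eq: "h (gmul g x) * gmul g w $ t
      = h (gmul g x) * gmul g y $ t - (x \<bullet> y) * (h (gmul g x) * gmul g x $ t)" for g :: "real^('m::finite \<times> 'n)"
    by (simp add: w_def gmul_diff gmul_scaleR algebra_simps)
  let ?S = "reflect w"
  note S = orthogonal_transformation_reflect[of w]
  let ?T = "row_lift ?S :: real^('m::finite \<times> 'n) \<Rightarrow> _"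
  note T = orthogonal_transformation_row_lift[OF S]
  have "gmul (?T g) x = gmul g x" "gmul (?T g) w = - gmul g w" for g
    \<comment> \<open>The second instance is taken at \<open>- w\<close> because the reflection
      sends \<open>- w\<close> to \<open>w\<close>.\<close>
    using gmul_row_lift[OF S, of g x] gmul_row_lift[OF S, of g "- w"] S[THEN orthogonal_transformation_linear, THEN linear_neg, of w]
    by (simp_all add: reflect_orthogonal[OF xw] reflect_self gmul_minus)
  then have "- (\<integral>g. h (gmul g x) * gmul g w $ t \<partial>?G) = (\<integral>g. h (gmul (?T g) x) * gmul (?T g) w $ t \<partial>?G)"
    by simp
  also have "\<dots> = (\<integral>g. h (gmul g x) * gmul g w $ t \<partial>?G)"
    by (rule integral_std_gaussian_orthogonal[OF T]) measurable
  finally have "(\<integral>g. h (gmul g x) * gmul g w $ t \<partial>?G) = 0" by simp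
  then have "(\<integral>g. h (gmul g x) * gmul g y $ t \<partial>?G) = (x \<bullet> y) * (\<integral>g. h (gmul g x) * gmul g x $ t \<partial>?G)"
    unfolding eq using int[OF x] int[OF y] by simp
  also have "(\<integral>g. h (gmul g x) * gmul g x $ t \<partial>?G) = (\<integral>z. h z * z $ t \<partial>std_gaussian)"
    by (rule integral_gmul[OF x, of "\<lambda>z. h z * z $ t"]) measurable
  finally show "(\<integral>g. h (gmul g x) * gmul g y $ t \<partial>?G) = (x \<bullet> y) * (\<integral>z. h z * z $ t \<partial>std_gaussian)" .
qed

subsection \<open>Moments of partitions\<close>

lemma integrable_std_gaussian_id: "integrable (std_gaussian :: (real^'m) measure) (\<lambda>x. x)"
proof -
  have "(\<lambda>x :: real^'m. x) = (\<lambda>x. \<Sum>i\<in>UNIV. x $ i *\<^sub>R axis i 1)"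
    by (simp add: basis_expansion flip: scalar_mult_eq_scaleR)
  moreover have "integrable std_gaussian (\<lambda>x :: real^'m. \<Sum>i\<in>UNIV. x $ i *\<^sub>R axis i 1 :: real^'m)"
    using integrable_std_gaussian_nth by (intro Bochner_Integration.integrable_sum integrable_scaleR_left) auto
  ultimately show ?thesis by simp
qed

lemma integrable_std_gaussian_indicator:
  assumes "S \<in> sets borel"
  shows "integrable (std_gaussian :: (real^'m) measure) (\<lambda>x. indicator S x *\<^sub>R x)"
  using assms by (intro integrable_mult_indicator integrable_std_gaussian_id) simp

text \<open>Pairing with \<open>w\<close> reduces vector moments to real integrals; an axis vector
  gives the coordinates, a general \<open>w\<close> the linear functionals of a partition.\<close>

lemma
  fixes w :: "real^'m"
  assumes S: "S \<in> sets borel"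
  shows integrable_indicator_inner: "integrable std_gaussian (\<lambda>x. indicator S x * (w \<bullet> x))"
    and inner_gaussian_moment: "w \<bullet> gaussian_moment S = (\<integral>x. indicator S x * (w \<bullet> x) \<partial>std_gaussian)"
proof -
  note int = integrable_std_gaussian_indicator[OF S]
  show "integrable std_gaussian (\<lambda>x. indicator S x * (w \<bullet> x))"
    using integrable_inner_right[of w, OF int] by simp
  show "w \<bullet> gaussian_moment S = (\<integral>x. indicator S x * (w \<bullet> x) \<partial>std_gaussian)"
    unfolding gaussian_moment_def set_lebesgue_integral_def
    using integral_inner_right[of w std_gaussian "\<lambda>x. indicator S x *\<^sub>R x"] int by simp
qed

lemma gaussian_moment_nth:
  assumes "S \<in> sets borel"
  shows "gaussian_moment S $ t = (\<integral>x. indicator S x * x $ t \<partial>std_gaussian)"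
  using inner_gaussian_moment[OF assms, of "axis t 1"] by (simp add: inner_axis')

text \<open>The bound does not depend on \<open>S\<close>, which makes the set of all moment vectors
  bounded.\<close>

lemma norm_gaussian_moment_le:
  fixes S :: "(real^'m) set"
  assumes S: "S \<in> sets borel"
  shows "norm (gaussian_moment S) \<le> (\<integral>x. norm x \<partial>(std_gaussian :: (real^'m) measure))"
proof -
  note int = integrable_std_gaussian_indicator[OF S]
  have "norm (gaussian_moment S) \<le> (\<integral>x. norm (indicator S x *\<^sub>R x) \<partial>std_gaussian)"
    unfolding gaussian_moment_def set_lebesgue_integral_def by (rule integral_norm_bound)
  also have "\<dots> \<le> (\<integral>x. norm x \<partial>(std_gaussian :: (real^'m) measure))"
    by (rule integral_mono[OF integrable_norm[OF int] integrable_norm[OF integrable_std_gaussian_id]])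
      (simp add: indicator_def)
  finally show ?thesis .
qed

section \<open>Partitions as labellings; cells of maximal inner product\<close>

lemma meas_partition_label:
  assumes "meas_partition P"
  shows "\<exists>p. \<forall>q y. y \<in> P q \<longleftrightarrow> q = p y"
proof (intro exI allI)
  show "y \<in> P q \<longleftrightarrow> q = (SOME q. y \<in> P q)" for q y
  proof -
    have "\<exists>q. y \<in> P q" using assms by (auto simp: meas_partition_def)
    then have "y \<in> P (SOME q. y \<in> P q)" by (rule someI_ex)
    then show ?thesis
      using assms by (auto simp: meas_partition_def disjoint_family_on_def)
  qed
qed

lemma sum_indicator_label:
  fixes f :: "'k::finite \<Rightarrow> real"
  assumes "\<And>q. y \<in> P q \<longleftrightarrow> q = p"
  shows "(\<Sum>q\<in>UNIV. indicator (P q) y * f q) = f p"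
proof -
  have "(\<Sum>q\<in>UNIV. indicator (P q) y * f q) = (\<Sum>q\<in>UNIV. if q = p then f q else 0)"
    by (rule sum.cong) (auto simp: indicator_def assms)
  then show ?thesis by simp
qed

text \<open>A point goes to an index maximising \<open>w i \<bullet> x\<close>. Ties are broken by
  the least value of the injection \<open>e\<close>, which makes the cells disjoint while they still
  cover the space.\<close>

lemma meas_partition_argmax:
  fixes w :: "'k::finite \<Rightarrow> real^'m"
  shows "\<exists>P. meas_partition P \<and> (\<forall>i. \<forall>x\<in>P i. \<forall>j. w j \<bullet> x \<le> w i \<bullet> x)"
proof -
  obtain e :: "'k \<Rightarrow> nat" where e: "inj e"
    using finite_imp_inj_to_nat_seg[of "UNIV :: 'k set"] by auto
  define P where "P i = {x. \<forall>j. w j \<bullet> x \<le> w i \<bullet> x \<and> (e j < e i \<longrightarrow> w j \<bullet> x < w i \<bullet> x)}" for i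
  have "P i \<in> sets borel" for i
    unfolding P_def by measurable
  moreover have "disjoint_family P"
  proof -
    have "i = j" if "x \<in> P i" "x \<in> P j" for i j x
    proof -
      have "w j \<bullet> x \<le> w i \<bullet> x" "w i \<bullet> x \<le> w j \<bullet> x"
        "e j < e i \<Longrightarrow> w j \<bullet> x < w i \<bullet> x" "e i < e j \<Longrightarrow> w i \<bullet> x < w j \<bullet> x"
        using that by (simp_all add: P_def)
      then have "e i = e j" by (meson leD linorder_neqE_nat)
      then show ?thesis using e by (simp add: inj_eq)
    qed
    then show ?thesis by (auto simp: disjoint_family_on_def)
  qed
  moreover have "\<exists>i. x \<in> P i" for x
  proof -
    let ?I = "{i. \<forall>j. w j \<bullet> x \<le> w i \<bullet> x}"
    have "\<exists>i. \<forall>j. w j \<bullet> x \<le> w i \<bullet> x"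
    proof -
      have "Max (range (\<lambda>i. w i \<bullet> x)) \<in> range (\<lambda>i. w i \<bullet> x)"
        by (rule Max_in) auto
      then obtain i where "Max (range (\<lambda>i. w i \<bullet> x)) = w i \<bullet> x" by (rule imageE)
      then have "w j \<bullet> x \<le> w i \<bullet> x" for j
        by (metis Max_ge finite finite_imageI rangeI)
      then show ?thesis by blast
    qed
    then obtain i0 where "i0 \<in> ?I" by auto
    then obtain i where i: "i \<in> ?I" "\<And>j. j \<in> ?I \<Longrightarrow> e i \<le> e j"
      using ex_has_least_nat[of "\<lambda>i. i \<in> ?I" i0 e] by blast
    have "w j \<bullet> x < w i \<bullet> x" if "e j < e i" for j
    proof (rule ccontr)
      assume "\<not> w j \<bullet> x < w i \<bullet> x"
      then have "j \<in> ?I" using i(1) by (auto intro: order_trans)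
      then show False using i(2) that by force
    qed
    then show ?thesis using i(1) by (auto simp: P_def)
  qed
  ultimately have "meas_partition P"
    by (auto simp: meas_partition_def)
  then show ?thesis by (intro exI[of _ P]) (simp add: P_def)
qed

text \<open>Expanding the inner products of the moments in coordinates \<open>t\<close> turns the
  Gram form into a sum of inner products, one for each \<open>t\<close>, in the space of the vectors
  \<open>v i\<close>. Positivity and convexity are read off from this.\<close>

lemma gram_bilinear:
  fixes v :: "'k::finite \<Rightarrow> 'a::real_inner" and y z :: "'k \<Rightarrow> real^'m"
  shows "(\<Sum>i\<in>UNIV. \<Sum>j\<in>UNIV. (v i \<bullet> v j) * (y i \<bullet> z j))
    = (\<Sum>t\<in>UNIV. (\<Sum>i\<in>UNIV. y i $ t *\<^sub>R v i) \<bullet> (\<Sum>j\<in>UNIV. z j $ t *\<^sub>R v j))"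
proof -
  have "(\<Sum>i\<in>UNIV. \<Sum>j\<in>UNIV. (v i \<bullet> v j) * (y i \<bullet> z j))
    = (\<Sum>i\<in>UNIV. \<Sum>j\<in>UNIV. \<Sum>t\<in>UNIV. y i $ t * (z j $ t * (v i \<bullet> v j)))"
    by (simp add: inner_vec_def[where 'b='m] sum_distrib_left mult_ac)
  also have "\<dots> = (\<Sum>i\<in>UNIV. \<Sum>t\<in>UNIV. \<Sum>j\<in>UNIV. y i $ t * (z j $ t * (v i \<bullet> v j)))"
    by (intro sum.cong refl sum.swap)
  also have "\<dots> = (\<Sum>t\<in>UNIV. \<Sum>i\<in>UNIV. \<Sum>j\<in>UNIV. y i $ t * (z j $ t * (v i \<bullet> v j)))"
    by (rule sum.swap)
  also have "\<dots> = (\<Sum>t\<in>UNIV. (\<Sum>i\<in>UNIV. y i $ t *\<^sub>R v i) \<bullet> (\<Sum>j\<in>UNIV. z j $ t *\<^sub>R v j))"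
    by (simp only: inner_sum_left) (simp add: inner_sum_right sum_distrib_left mult.left_commute)
  finally show ?thesis .
qed

lemma gram_nonneg:
  fixes v :: "'k::finite \<Rightarrow> 'a::real_inner" and z :: "'k \<Rightarrow> real^'m"
  shows "0 \<le> (\<Sum>i\<in>UNIV. \<Sum>j\<in>UNIV. (v i \<bullet> v j) * (z i \<bullet> z j))"
  unfolding gram_bilinear by (intro sum_nonneg) auto

text \<open>This is the convexity of the quadratic form: its tangent at \<open>z\<close> lies below
  it.\<close>

lemma gram_bilinear_le:
  fixes v :: "'k::finite \<Rightarrow> 'a::real_inner" and y z :: "'k \<Rightarrow> real^'m"
  shows "2 * (\<Sum>i\<in>UNIV. \<Sum>j\<in>UNIV. (v i \<bullet> v j) * (y i \<bullet> z j))
    \<le> (\<Sum>i\<in>UNIV. \<Sum>j\<in>UNIV. (v i \<bullet> v j) * (y i \<bullet> y j)) + (\<Sum>i\<in>UNIV. \<Sum>j\<in>UNIV. (v i \<bullet> v j) * (z i \<bullet> z j))"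
proof -
  have "2 * (a \<bullet> b) \<le> a \<bullet> a + b \<bullet> b" for a b :: 'a
    using inner_ge_zero[of "a - b"] by (simp add: inner_diff_left inner_diff_right inner_commute)
  then show ?thesis
    unfolding gram_bilinear sum.distrib[symmetric] sum_distrib_left by (intro sum_mono)
qed

section \<open>Existence of an optimal partition\<close>

definition moment_value :: "('k::finite \<Rightarrow> 'a::real_inner) \<Rightarrow> ('k \<Rightarrow> (real^'m) set) \<Rightarrow> real" where
  "moment_value v P = (\<Sum>i\<in>UNIV. \<Sum>j\<in>UNIV.
     (v i \<bullet> v j) * (gaussian_moment (P i) \<bullet> gaussian_moment (P j)))"

lemma moment_value_attains_max:
  fixes v :: "'k::finite \<Rightarrow> 'a::real_inner"
  shows "\<exists>P :: 'k \<Rightarrow> (real^'m) set. meas_partition P \<and>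
    (\<forall>P' :: 'k \<Rightarrow> (real^'m) set. meas_partition P' \<longrightarrow> moment_value v P' \<le> moment_value v P)"
proof -
  define mom :: "('k \<Rightarrow> (real^'m) set) \<Rightarrow> real^'m^'k" where "mom P = (\<chi> i. gaussian_moment (P i))" for P
  \<comment> \<open>\<open>K\<close> is not shown to be closed, so the maximiser \<open>z\<close>
    below lies in its closure and need not come from a partition.\<close>
  define K where "K = mom ` {P. meas_partition P}"
  define bil :: "real^'m^'k \<Rightarrow> real^'m^'k \<Rightarrow> real" where
    "bil y z = (\<Sum>i\<in>UNIV. \<Sum>j\<in>UNIV. (v i \<bullet> v j) * (y $ i \<bullet> z $ j))" for y z
  have val: "moment_value v P = bil (mom P) (mom P)" for P :: "'k \<Rightarrow> (real^'m) set"
    by (simp add: moment_value_def bil_def mom_def)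
  let ?b = "\<integral>x. norm x \<partial>(std_gaussian :: (real^'m) measure)"
  have "norm z \<le> (\<Sum>i\<in>(UNIV :: 'k set). ?b)" if "z \<in> K" for z
  proof -
    have "norm z \<le> (\<Sum>i\<in>UNIV. norm (z $ i))"
      unfolding norm_vec_def by (rule L2_set_le_sum) simp
    also have "\<dots> \<le> (\<Sum>i\<in>(UNIV :: 'k set). ?b)"
      using that by (intro sum_mono) (auto simp: K_def mom_def meas_partition_def intro!: norm_gaussian_moment_le)
    finally show ?thesis .
  qed
  then have "bounded K" unfolding bounded_iff by blast
  then have "compact (closure K)" by (simp add: compact_closure)
  moreover have "closure K \<noteq> {}"
  proof -
    obtain P :: "'k \<Rightarrow> (real^'m) set" where "meas_partition P"
      using meas_partition_argmax[of "\<lambda>_. 0"] by blast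
    then show ?thesis by (auto simp: K_def)
  qed
  moreover have "continuous_on (closure K) (\<lambda>z. bil z z)"
    unfolding bil_def by (intro continuous_intros)
  ultimately obtain z where z: "z \<in> closure K" and zmax: "\<And>y. y \<in> closure K \<Longrightarrow> bil y y \<le> bil z z"
    using continuous_attains_sup[of "closure K" "\<lambda>z. bil z z"] by blast
  \<comment> \<open>The functional \<open>bil _ z\<close> with coefficients \<open>w\<close> is half
    the derivative at \<open>z\<close> of the quadratic form.\<close>
  define w where "w i = (\<Sum>j\<in>UNIV. (v i \<bullet> v j) *\<^sub>R (z $ j))" for i
  have w: "(\<Sum>i\<in>UNIV. w i \<bullet> y $ i) = bil y z" for y
    unfolding w_def bil_def inner_sum_left
    by (intro sum.cong refl) (simp add: inner_commute[of "y $ _"])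
  obtain P where P: "meas_partition P" and Pw: "\<And>i j x. x \<in> P i \<Longrightarrow> w j \<bullet> x \<le> w i \<bullet> x"
    using meas_partition_argmax[of w] by blast
  have bil_mom: "integrable std_gaussian (\<lambda>x. \<Sum>i\<in>UNIV. indicator (P' i) x * (w i \<bullet> x))"
    "bil (mom P') z = (\<integral>x. (\<Sum>i\<in>UNIV. indicator (P' i) x * (w i \<bullet> x)) \<partial>std_gaussian)"
    if "meas_partition P'" for P'
  proof -
    have "P' i \<in> sets borel" for i using that by (simp add: meas_partition_def)
    note int = integrable_indicator_inner[OF this] and mo = inner_gaussian_moment[OF this]
    show "integrable std_gaussian (\<lambda>x. \<Sum>i\<in>UNIV. indicator (P' i) x * (w i \<bullet> x))"
      by (intro Bochner_Integration.integrable_sum int)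
    show "bil (mom P') z = (\<integral>x. (\<Sum>i\<in>UNIV. indicator (P' i) x * (w i \<bullet> x)) \<partial>std_gaussian)"
      by (subst Bochner_Integration.integral_sum[OF int]) (simp add: mom_def mo flip: w)
  qed
  have "bil (mom P') z \<le> bil (mom P) z" if P': "meas_partition P'" for P'
    unfolding bil_mom(2)[OF P'] bil_mom(2)[OF P]
  proof (rule integral_mono[OF bil_mom(1)[OF P'] bil_mom(1)[OF P]])
    fix x
    obtain p' where p': "\<And>q y. y \<in> P' q \<longleftrightarrow> q = p' y" using meas_partition_label[OF P'] by blast
    obtain p where p: "\<And>q y. y \<in> P q \<longleftrightarrow> q = p y" using meas_partition_label[OF P] by blast
    \<comment> \<open>At each point only the cell containing it contributes, and the label given by
      \<open>P\<close> has the largest \<open>w i \<bullet> x\<close>. The integrals are thus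
      compared pointwise.\<close>
    show "(\<Sum>i\<in>UNIV. indicator (P' i) x * (w i \<bullet> x)) \<le> (\<Sum>i\<in>UNIV. indicator (P i) x * (w i \<bullet> x))"
      unfolding sum_indicator_label[of x P', OF p'] sum_indicator_label[of x P, OF p]
      by (rule Pw) (simp add: p)
  qed
  \<comment> \<open>The linear inequality defines a closed set, so it extends from \<open>K\<close>
    to its closure and holds at \<open>z\<close>.\<close>
  then have "K \<subseteq> {y. bil y z \<le> bil (mom P) z}" by (auto simp: K_def)
  moreover have "closed {y. bil y z \<le> bil (mom P) z}"
    by (intro closed_Collect_le continuous_on_const) (unfold bil_def, intro continuous_intros)
  ultimately have "bil z z \<le> bil (mom P) z"
    using z closure_minimal by blast
  \<comment> \<open>Together with the previous inequality, convexity shows that the value at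
    \<open>mom P\<close> is at least that at \<open>z\<close>; hence the maximum on the closure is
    attained by the partition \<open>P\<close>.\<close>
  moreover have "2 * bil (mom P) z \<le> bil (mom P) (mom P) + bil z z"
    unfolding bil_def by (rule gram_bilinear_le)
  ultimately have lower: "bil z z \<le> moment_value v P"
    unfolding val by linarith
  have upper: "moment_value v P' \<le> bil z z" if "meas_partition P'" for P' :: "'k \<Rightarrow> (real^'m) set"
    unfolding val using that by (intro zmax subsetD[OF closure_subset]) (auto simp: K_def)
  show ?thesis
    using P order_trans[OF upper lower] by blast
qed

subsection \<open>Rounding\<close>

text \<open>Separating the coordinates \<open>c\<close> of the vectors gives a sum of values of the
  quadratic form of \<open>A\<close>, one at each vector of \<open>c\<close>-th coordinates.\<close>

lemma sym_psd_sum_nonneg: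
  fixes A :: "real^'n^'n" and w :: "'n \<Rightarrow> real^'k"
  assumes "sym_psd A"
  shows "0 \<le> (\<Sum>i\<in>UNIV. \<Sum>j\<in>UNIV. A $ i $ j * (w i \<bullet> w j))"
proof -
  have "(\<Sum>i\<in>UNIV. \<Sum>j\<in>UNIV. A $ i $ j * (w i \<bullet> w j))
      = (\<Sum>i\<in>UNIV. \<Sum>j\<in>UNIV. \<Sum>c\<in>UNIV. w i $ c * (A $ i $ j * w j $ c))"
    by (simp add: inner_vec_def sum_distrib_left mult_ac)
  also have "\<dots> = (\<Sum>i\<in>UNIV. \<Sum>c\<in>UNIV. \<Sum>j\<in>UNIV. w i $ c * (A $ i $ j * w j $ c))"
    by (intro sum.cong refl sum.swap)
  also have "\<dots> = (\<Sum>c\<in>UNIV. \<Sum>i\<in>UNIV. \<Sum>j\<in>UNIV. w i $ c * (A $ i $ j * w j $ c))"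
    by (rule sum.swap)
  also have "\<dots> = (\<Sum>c\<in>UNIV. (\<chi> i. w i $ c) \<bullet> (A *v (\<chi> i. w i $ c)))"
    by (simp add: inner_vec_def matrix_vector_mult_def sum_distrib_left)
  also have "\<dots> \<ge> 0"
    using assms by (intro sum_nonneg) (simp add: sym_psd_def)
  finally show ?thesis .
qed

text \<open>The bound holds for every measurable partition; the optimal one is inserted only in
  \<open>theorem3p1\<close>.\<close>

lemma rounding_bound:
  fixes A :: "real^'n^'n" and v :: "'k::finite \<Rightarrow> real^'k" and P :: "'k \<Rightarrow> (real^'m) set"
    and x :: "'n \<Rightarrow> real^'n"
  assumes A: "sym_psd A" and P: "meas_partition P" and x: "\<And>i. norm (x i) = 1"
  shows "moment_value v P * (\<Sum>i\<in>UNIV. \<Sum>j\<in>UNIV. A $ i $ j * (x i \<bullet> x j))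
    \<le> (MAX \<sigma> :: 'n \<Rightarrow> 'k. \<Sum>i\<in>UNIV. \<Sum>j\<in>UNIV. A $ i $ j * (v (\<sigma> i) \<bullet> v (\<sigma> j)))"
proof -
  let ?G = "std_gaussian :: (real^('m \<times> 'n)) measure"
  let ?S = "\<lambda>\<sigma> :: 'n \<Rightarrow> 'k. \<Sum>i\<in>UNIV. \<Sum>j\<in>UNIV. A $ i $ j * (v (\<sigma> i) \<bullet> v (\<sigma> j))"
  obtain p where p: "\<And>q y. y \<in> P q \<longleftrightarrow> q = p y" using meas_partition_label[OF P] by blast
  have Pm [measurable]: "P q \<in> sets borel" for q using P by (simp add: meas_partition_def)
  define F where "F y = v (p y)" for y
  define c where "c t = (\<Sum>q\<in>UNIV. gaussian_moment (P q) $ t *\<^sub>R v q)" for t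
  define L where "L y = (\<Sum>t\<in>UNIV. y $ t *\<^sub>R c t)" for y
  have F: "F y \<bullet> u = (\<Sum>q\<in>UNIV. indicator (P q) y * (v q \<bullet> u))" for y u
    unfolding F_def by (rule sum_indicator_label[symmetric]) (rule p)
  have Fm [measurable]: "(\<lambda>y. F y \<bullet> u) \<in> borel_measurable borel" for u
    unfolding F by measurable
  \<comment> \<open>\<open>F\<close> takes finitely many values: the square is the summand for
    \<open>q = p y\<close> of the constant bound.\<close>
  have F2: "integrable std_gaussian (\<lambda>y. (F y \<bullet> u)\<^sup>2)" for u
  proof (rule std_gaussian.integrable_const_bound)
    show "AE y in std_gaussian. norm ((F y \<bullet> u)\<^sup>2) \<le> (\<Sum>q\<in>UNIV. (v q \<bullet> u)\<^sup>2)"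
      by (rule AE_I2) (auto simp: F_def intro: member_le_sum)
  qed measurable
  \<comment> \<open>This identifies \<open>c t\<close> as the coefficient of the coordinate
    \<open>y $ t\<close> in the linear part of \<open>F\<close>.\<close>
  have Fy: "(\<integral>y. (F y \<bullet> u) * y $ t \<partial>std_gaussian) = c t \<bullet> u" for u t
  proof -
    have int: "integrable std_gaussian (\<lambda>y. indicator (P q) y * y $ t)" for q
      using integrable_indicator_inner[OF Pm[of q], of "axis t 1"] by (simp add: inner_axis')
    have "(F y \<bullet> u) * y $ t = (\<Sum>q\<in>UNIV. (v q \<bullet> u) * (indicator (P q) y * y $ t))" for y
      unfolding F sum_distrib_right by (simp only: mult_ac)
    then have "(\<integral>y. (F y \<bullet> u) * y $ t \<partial>std_gaussian)
        = (\<Sum>q\<in>UNIV. (v q \<bullet> u) * (\<integral>y. indicator (P q) y * y $ t \<partial>std_gaussian))"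
      using int by simp
    then show ?thesis
      by (simp add: c_def inner_sum_left gaussian_moment_nth mult.commute)
  qed
  define N where "N = (\<Sum>t\<in>UNIV. c t \<bullet> c t)"
  have N: "moment_value v P = N"
    unfolding moment_value_def gram_bilinear N_def c_def ..
  define X where "X i g = gmul g (x i)" for i and g :: "real^('m \<times> 'n)"
  have FL: "integrable ?G (\<lambda>g. F (X i g) \<bullet> L (X j g))"
    "(\<integral>g. F (X i g) \<bullet> L (X j g) \<partial>?G) = (x i \<bullet> x j) * N" for i j
  proof -
    have eq: "F (X i g) \<bullet> L (X j g) = (\<Sum>t\<in>UNIV. (F (gmul g (x i)) \<bullet> c t) * gmul g (x j) $ t)" for g
      by (simp add: L_def X_def inner_sum_right mult.commute)
    \<comment> \<open>The role of \<open>h\<close> is played by \<open>F y \<bullet> c t\<close> as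
      a function of \<open>y\<close>; \<open>Fy\<close> at \<open>u = c t\<close> then yields the
      squared norm of \<open>c t\<close>.\<close>
    note int = integrable_gmul_mult[OF x x Fm F2]
    show "integrable ?G (\<lambda>g. F (X i g) \<bullet> L (X j g))"
      unfolding eq by (intro Bochner_Integration.integrable_sum int)
    show "(\<integral>g. F (X i g) \<bullet> L (X j g) \<partial>?G) = (x i \<bullet> x j) * N"
      unfolding eq Bochner_Integration.integral_sum[OF int] integral_gmul_mult[OF x x Fm F2] Fy N_def
      by (simp add: sum_distrib_left)
  qed
  have LL: "integrable ?G (\<lambda>g. L (X i g) \<bullet> L (X j g))"
    "(\<integral>g. L (X i g) \<bullet> L (X j g) \<partial>?G) = (x i \<bullet> x j) * N" for i j
  proof -
    have eq: "L (X i g) \<bullet> L (X j g)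
        = (\<Sum>s\<in>UNIV. \<Sum>t\<in>UNIV. (c s \<bullet> c t) * (gmul g (x i) $ s * gmul g (x j) $ t))" for g
      by (simp only: L_def X_def inner_sum_left) (simp add: inner_sum_right sum_distrib_left mult_ac)
    \<comment> \<open>Here \<open>h\<close> is a coordinate, and orthonormality of the coordinates
      leaves only the terms with \<open>s = t\<close>.\<close>
    note int = integrable_gmul_mult[OF x x borel_measurable_nth integrable_std_gaussian_nth_square]
    note int' = integrable_mult_right[OF int]
    note val = integral_gmul_mult[OF x x borel_measurable_nth integrable_std_gaussian_nth_square]
    show "integrable ?G (\<lambda>g. L (X i g) \<bullet> L (X j g))"
      unfolding eq by (intro Bochner_Integration.integrable_sum int')
    have "(\<integral>g. L (X i g) \<bullet> L (X j g) \<partial>?G)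
        = (\<Sum>s\<in>UNIV. \<Sum>t\<in>UNIV. (c s \<bullet> c t) * ((x i \<bullet> x j) * (if s = t then 1 else 0)))"
      unfolding eq
      by (subst Bochner_Integration.integral_sum, intro Bochner_Integration.integrable_sum int',
          subst Bochner_Integration.integral_sum, rule int')
        (simp add: int val integral_std_gaussian_nth_mult)
    also have "\<dots> = (x i \<bullet> x j) * N"
      by (simp add: N_def sum_distrib_left if_distrib mult.commute cong: if_cong)
    finally show "(\<integral>g. L (X i g) \<bullet> L (X j g) \<partial>?G) = (x i \<bullet> x j) * N" .
  qed
  let ?H = "\<lambda>g. \<Sum>i\<in>UNIV. \<Sum>j\<in>UNIV.
    A $ i $ j * (F (X i g) \<bullet> L (X j g) + F (X j g) \<bullet> L (X i g) - L (X i g) \<bullet> L (X j g))"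
  \<comment> \<open>The estimate holds for each \<open>g\<close> separately: the labels
    \<open>p (X i g)\<close> form an assignment, so the products of \<open>F\<close> with
    \<open>F\<close> are bounded by the maximum and never integrated.\<close>
  have H: "?H g \<le> (MAX \<sigma>. ?S \<sigma>)" for g
  proof -
    have "0 \<le> (\<Sum>i\<in>UNIV. \<Sum>j\<in>UNIV.
        A $ i $ j * ((F (X i g) - L (X i g)) \<bullet> (F (X j g) - L (X j g))))"
      by (rule sym_psd_sum_nonneg[OF A])
    also have "\<dots> = (\<Sum>i\<in>UNIV. \<Sum>j\<in>UNIV. A $ i $ j * (F (X i g) \<bullet> F (X j g))
        - A $ i $ j * (F (X i g) \<bullet> L (X j g) + F (X j g) \<bullet> L (X i g) - L (X i g) \<bullet> L (X j g)))"
      by (intro sum.cong refl)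
        (simp add: inner_diff_left inner_diff_right inner_commute[of "L _" "F _"] algebra_simps)
    also have "\<dots> = ?S (\<lambda>i. p (X i g)) - ?H g"
      by (simp add: F_def sum_subtractf)
    also have "?S (\<lambda>i. p (X i g)) \<le> (MAX \<sigma>. ?S \<sigma>)"
      by (rule Max_ge) auto
    finally show ?thesis by simp
  qed
  have iH: "integrable ?G ?H"
    using FL(1) LL(1) by (intro Bochner_Integration.integrable_sum integrable_mult_right
      Bochner_Integration.integrable_add Bochner_Integration.integrable_diff)
  \<comment> \<open>Each of the three products has expectation
    \<open>(x i \<bullet> x j) * N\<close>; with signs \<open>1 + 1 - 1\<close> one copy
    remains.\<close>
  have "(\<integral>g. ?H g \<partial>?G) = (\<Sum>i\<in>UNIV. \<Sum>j\<in>UNIV. A $ i $ j * ((x i \<bullet> x j) * N))"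
    using FL LL by (simp add: inner_commute[of "x _" "x _"] mult.commute[of N])
  also have "\<dots> = moment_value v P * (\<Sum>i\<in>UNIV. \<Sum>j\<in>UNIV. A $ i $ j * (x i \<bullet> x j))"
    by (simp add: N sum_distrib_left mult_ac)
  finally show ?thesis
    using std_gaussian.integral_le_const[OF iH, of "MAX \<sigma>. ?S \<sigma>"] H by simp
qed

section \<open>The maximum over the sphere and the final inequality\<close>

lemma sphere_form_attains_max:
  fixes A :: "real^'n^'n"
  shows "\<exists>x :: 'n \<Rightarrow> real^'n. (\<forall>i. x i \<in> sphere 0 1) \<and> (\<forall>y :: 'n \<Rightarrow> real^'n. (\<forall>i. y i \<in> sphere 0 1) \<longrightarrow>
      (\<Sum>i\<in>UNIV. \<Sum>j\<in>UNIV. A $ i $ j * (y i \<bullet> y j)) \<le> (\<Sum>i\<in>UNIV. \<Sum>j\<in>UNIV. A $ i $ j * (x i \<bullet> x j)))"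
proof -
  \<comment> \<open>Families of unit vectors are encoded as the rows of a matrix, so that
    compactness is that of a closed bounded subset of a Euclidean space.\<close>
  let ?K = "{X :: real^'n^'n. \<forall>i. norm (X $ i) = 1}"
  let ?f = "\<lambda>X :: real^'n^'n. \<Sum>i\<in>UNIV. \<Sum>j\<in>UNIV. A $ i $ j * (X $ i \<bullet> X $ j)"
  have "norm X \<le> real CARD('n)" if "X \<in> ?K" for X
    using that L2_set_le_sum[of UNIV "\<lambda>i. norm (X $ i)"] by (simp add: norm_vec_def)
  then have "bounded ?K" unfolding bounded_iff by blast
  moreover have "closed ?K"
    by (intro closed_Collect_all closed_Collect_eq continuous_intros)
  ultimately have "compact ?K" by (simp add: compact_eq_bounded_closed)
  moreover have "(\<chi> i. axis i 1) \<in> ?K" by simp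
  then have "?K \<noteq> {}" by blast
  moreover have "continuous_on ?K ?f" by (intro continuous_intros)
  ultimately obtain X where X: "X \<in> ?K" "\<And>Y. Y \<in> ?K \<Longrightarrow> ?f Y \<le> ?f X"
    using continuous_attains_sup[of ?K ?f] by blast
  show ?thesis
  proof (intro exI[of _ "\<lambda>i. X $ i"] conjI allI impI)
    show "X $ i \<in> sphere 0 1" for i using X(1) by simp
    show "(\<Sum>i\<in>UNIV. \<Sum>j\<in>UNIV. A $ i $ j * (y i \<bullet> y j)) \<le> ?f X"
      if "\<forall>i. y i \<in> sphere 0 1" for y :: "'n \<Rightarrow> real^'n"
      using X(2)[of "\<chi> i. y i"] that by simp
  qed
qed

text \<open>The hypothesis \<open>C\<close> gives the quotient its meaning, since
  \<open>1 / 0\<close> is 0 in HOL. Both occurrences of \<open>GREATEST\<close> are evaluated by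
  exhibiting a maximiser, after which \<open>rounding_bound\<close> is divided by the
  constant.\<close>

theorem theorem3p1:
  fixes A :: "real^'n^'n"
    and v :: "'k::finite \<Rightarrow> real^'k"
    and B :: "real^'k^'k"
  assumes A: "sym_psd A"
    and k: "CARD('k) \<ge> 2"
    and m: "CARD('m::finite) = CARD('k) - 1"
    and B: "\<And>i j. B $ i $ j = v i \<bullet> v j"
    and C: "gaussian_const TYPE(real^'m) B \<noteq> 0"
  shows "(GREATEST c. \<exists>x :: 'n \<Rightarrow> real^'n. (\<forall>i. x i \<in> sphere 0 1) \<and>
            c = (\<Sum>i\<in>UNIV. \<Sum>j\<in>UNIV. A $ i $ j * (x i \<bullet> x j)))
         \<le> 1 / gaussian_const TYPE(real^'m) B *
           (MAX \<sigma> :: 'n \<Rightarrow> 'k. \<Sum>i\<in>UNIV. \<Sum>j\<in>UNIV. A $ i $ j * (v (\<sigma> i) \<bullet> v (\<sigma> j)))"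
proof -
  let ?C = "gaussian_const TYPE(real^'m) B"
  obtain P :: "'k \<Rightarrow> (real^'m) set" where P: "meas_partition P"
    and Pmax: "\<And>P' :: 'k \<Rightarrow> (real^'m) set. meas_partition P' \<Longrightarrow> moment_value v P' \<le> moment_value v P"
    using moment_value_attains_max[of v] by blast
  have "?C = moment_value v P"
    unfolding gaussian_const_def
  proof (rule Greatest_equality)
    show "\<exists>P' :: 'k \<Rightarrow> (real^'m) set. meas_partition P' \<and> moment_value v P = (\<Sum>i\<in>UNIV. \<Sum>j\<in>UNIV.
        B $ i $ j * (gaussian_moment (P' i) \<bullet> gaussian_moment (P' j)))"
      using P by (auto simp: moment_value_def B)
    show "y \<le> moment_value v P" if "\<exists>P' :: 'k \<Rightarrow> (real^'m) set. meas_partition P' \<and> y = (\<Sum>i\<in>UNIV. \<Sum>j\<in>UNIV.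
        B $ i $ j * (gaussian_moment (P' i) \<bullet> gaussian_moment (P' j)))" for y
      using that Pmax by (auto simp: moment_value_def B)
  qed
  \<comment> \<open>A Gram form is nonnegative, so a nonzero constant is positive and division by it
    keeps the direction of the inequality.\<close>
  moreover have "0 \<le> moment_value v P"
    unfolding moment_value_def by (rule gram_nonneg)
  ultimately have C_eq: "?C = moment_value v P" and C_pos: "0 < ?C"
    using C by auto
  obtain x :: "'n \<Rightarrow> real^'n" where x: "\<And>i. x i \<in> sphere 0 1"
    and xmax: "\<And>y :: 'n \<Rightarrow> real^'n. (\<forall>i. y i \<in> sphere 0 1) \<Longrightarrow>
      (\<Sum>i\<in>UNIV. \<Sum>j\<in>UNIV. A $ i $ j * (y i \<bullet> y j)) \<le> (\<Sum>i\<in>UNIV. \<Sum>j\<in>UNIV. A $ i $ j * (x i \<bullet> x j))"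
    using sphere_form_attains_max[of A] by blast
  have "(GREATEST c. \<exists>x :: 'n \<Rightarrow> real^'n. (\<forall>i. x i \<in> sphere 0 1) \<and>
      c = (\<Sum>i\<in>UNIV. \<Sum>j\<in>UNIV. A $ i $ j * (x i \<bullet> x j))) = (\<Sum>i\<in>UNIV. \<Sum>j\<in>UNIV. A $ i $ j * (x i \<bullet> x j))"
    by (rule Greatest_equality) (use x xmax in blast)+
  then show ?thesis
    using rounding_bound[OF A P, of x v] x C_pos by (simp add: C_eq pos_le_divide_eq mult.commute)
qed

end
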